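(* Suppose $\mathcal X\subseteq[\boldsymbol l,\boldsymbol u]$ with $\boldsymbol l,\boldsymbol u\in\mathbb R^n$. Let $\hat l^b_k=\sum_{j\in[n]}\min\{\hat B_{kj}l_j,\hat B_{kj}u_j\}+\hat b_k$ and $\hat u^b_k=\sum_{j\in[n]}\max\{\hat B_{kj}l_j,\hat B_{kj}u_j\}+\hat b_k$, so that $b_k(\boldsymbol x)\in[\hat l^b_k,\hat u^b_k]$ for each $k\in[K]$, and let $\hat l^a_{ki}=\sum_{j\in[n]}\min\{\hat A_{kij}l_j,\hat A_{kij}u_j\}+\hat a_{ki}$ and $\hat u^a_{ki}=\sum_{j\in[n]}\max\{\hat A_{kij}l_j,\hat A_{kij}u_j\}+\hat a_{ki}$ for each $i\in[m]$, so that $\boldsymbol a_k(\boldsymbol x)\in[\hat{\boldsymbol l}^a_k,\hat{\boldsymbol u}^a_k]$ for each $k\in[K]$. When $p\in\{1,\infty\}$, the problem $$v^*=\min_{\boldsymbol x\in\mathcal X}\frac1N\sum_{i\in[N]}\min_{k\in[K]}\left\{{\boldsymbol\zeta^i}^\top\boldsymbol a_k(\boldsymbol x)+b_k(\boldsymbol x)-\theta\|\boldsymbol a_k(\boldsymbol x)\|_{p^*}\right\}$$ is MICP-R.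
   Context: $[K]=\{1,\dots,K\}$. $\mathcal X\subseteq\mathbb R^n$ is a compact convex set with non-empty relative interior. For $k\in[K]$, $\boldsymbol a_k(\boldsymbol x)=\hat{\boldsymbol A}_k\boldsymbol x+\hat{\boldsymbol a}_k\in\mathbb R^m$ and $b_k(\boldsymbol x)=\hat{\boldsymbol B}_k^\top\boldsymbol x+\hat b_k\in\mathbb R$ are affine; $\hat A_{kij}$, $\hat a_{ki}$, $\hat B_{kj}$ are the entries of $\hat{\boldsymbol A}_k,\hat{\boldsymbol a}_k,\hat{\boldsymbol B}_k$. $\boldsymbol\zeta^1,\dots,\boldsymbol\zeta^N\in\mathbb R^m$ are given sample points, $\theta\ge0$, and $\|\cdot\|_{p^*}$ is the dual norm of $\|\cdot\|_p$ ($1/p+1/p^*=1$). The displayed problem is the distributionally favorable optimization problem $\min_{\boldsymbol x\in\mathcal X}\inf_{\mathbb P}\mathbb E_{\mathbb P}[Q(\boldsymbol x,\tilde{\boldsymbol\xi})]$ over the type-$\infty$ Wasserstein ball of radius $\theta$ (with norm $\|\cdot\|_p$) around the empirical distribution of $\{\boldsymbol\zeta^i\}$, with $Q(\boldsymbol x,\boldsymbol\xi)=\min_{k\in[K]}\{\boldsymbol\xi^\top\boldsymbol a_k(\boldsymbol x)+b_k(\boldsymbol x)\}$. MICP-R (mixed-integer convex programming representable): a set $S\subseteq\mathbb R^n$ is MICP-R if there are integers $r,d$ and a closed convex set $M\subseteq\mathbb R^{n+r+d}$ such that $\boldsymbol x\in S$ if and only if there exist $\boldsymbol y\in\mathbb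 R^r$, $\boldsymbol z\in\mathbb Z^d$ with $(\boldsymbol x,\boldsymbol y,\boldsymbol z)\in M$. A function $f:S\to\mathbb R$ is MICP-R if both its domain $S$ and its epigraph $\{(\boldsymbol x,t):\boldsymbol x\in S,\ f(\boldsymbol x)\le t\}$ are MICP-R. A mathematical program is MICP-R if both its feasible region and its objective function (here, a function of $\boldsymbol x$ with domain $\mathcal X$) are MICP-R. *)

theory Defs
  imports "HOL-Analysis.Analysis"
begin

(* Since the numbers r of continuous and d of integer auxiliary variables are existentially
   quantified, R^r and Z^d cannot be types. They are taken inside Euclidean_space r and
   Euclidean_space d, whose points are the functions nat => real vanishing from index r (d) on.
   The function space carries no vector space class, hence convexity is written out. *)

definition convex_ambient ::
  "('a::euclidean_space \<times> (nat \<Rightarrow> real) \<times> (nat \<Rightarrow> real)) set \<Rightarrow> bool"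
  where "convex_ambient M \<longleftrightarrow>
    (\<forall>x y z x' y' z' s t. (x, y, z) \<in> M \<and> (x', y', z') \<in> M \<and> 0 \<le> s \<and> 0 \<le> t \<and> s + t = 1 \<longrightarrow>
       (s *\<^sub>R x + t *\<^sub>R x', (\<lambda>i. s * y i + t * y' i), (\<lambda>i. s * z i + t * z' i)) \<in> M)"

definition micp_r_set :: "'a::euclidean_space set \<Rightarrow> bool"
  where "micp_r_set S \<longleftrightarrow>
    (\<exists>r d M.
       closedin (prod_topology euclidean (prod_topology (Euclidean_space r) (Euclidean_space d))) M \<and>
       convex_ambient M \<and>
       (\<forall>x. x \<in> S \<longleftrightarrow>
          (\<exists>y \<in> topspace (Euclidean_space r). \<exists>z \<in> topspace (Euclidean_space d).
             (\<forall>i<d. z i \<in> \<int>) \<and> (x, y, z) \<in> M)))"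

definition micp_r_fun :: "'a::euclidean_space set \<Rightarrow> ('a \<Rightarrow> real) \<Rightarrow> bool"
  where "micp_r_fun S f \<longleftrightarrow> micp_r_set S \<and> micp_r_set {(x, t). x \<in> S \<and> f x \<le> t}"

(* The program "minimize f x over x in S"; f matters only on its domain S. *)
definition micp_r_program :: "'a::euclidean_space set \<Rightarrow> ('a \<Rightarrow> real) \<Rightarrow> bool"
  where "micp_r_program S f \<longleftrightarrow> micp_r_set S \<and> micp_r_fun S f"

(* A norm for 1 <= p <= infinity. *)
definition lp_norm :: "ereal \<Rightarrow> real ^ 'm \<Rightarrow> real"
  where "lp_norm p x =
    (if p = \<infinity> then Max (range (\<lambda>i. \<bar>x $ i\<bar>))
     else (\<Sum>i\<in>UNIV. \<bar>x $ i\<bar> powr real_of_ereal p) powr (1 / real_of_ereal p))"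

definition dual_norm :: "(real ^ 'm \<Rightarrow> real) \<Rightarrow> real ^ 'm \<Rightarrow> real"
  where "dual_norm \<nu> a = (SUP z\<in>{z. \<nu> z \<le> 1}. a \<bullet> z)"

lemma lp_norm_1: "lp_norm 1 x = (\<Sum>i\<in>UNIV. \<bar>x $ i\<bar>)"
  by (simp add: lp_norm_def sum_nonneg)

lemma lp_norm_infinity: "lp_norm \<infinity> x = Max (range (\<lambda>i. \<bar>x $ i\<bar>))"
  by (simp add: lp_norm_def)

lemma lp_norm_infinity_ge: "\<bar>x $ i\<bar> \<le> lp_norm \<infinity> x"
  unfolding lp_norm_infinity by (rule Max_ge) auto

(* For p = 1 and p = infinity the dual of the p-norm is the q-norm with 1/p + 1/q = 1. *)

lemma dual_norm_lp_1: "dual_norm (lp_norm 1) a = lp_norm \<infinity> a"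
  unfolding dual_norm_def
proof (rule cSup_eq_maximum)
  have "lp_norm \<infinity> a \<in> range (\<lambda>i. \<bar>a $ i\<bar>)"
    unfolding lp_norm_infinity by (rule Max_in) auto
  then obtain i where i: "lp_norm \<infinity> a = \<bar>a $ i\<bar>" by blast
  let ?z = "axis i (sgn (a $ i))"
  have "lp_norm 1 ?z = (\<Sum>j\<in>UNIV. if j = i then \<bar>sgn (a $ i)\<bar> else 0)"
    unfolding lp_norm_1 by (rule sum.cong) (auto simp: axis_def)
  also have "\<dots> \<le> 1" by (simp add: sgn_if)
  finally have "?z \<in> {z. lp_norm 1 z \<le> 1}" by simp
  moreover have "a \<bullet> ?z = lp_norm \<infinity> a"
    by (simp add: i inner_axis abs_sgn)
  ultimately show "lp_norm \<infinity> a \<in> (\<lambda>z. a \<bullet> z) ` {z. lp_norm 1 z \<le> 1}"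
    by (metis imageI)
next
  fix v assume "v \<in> (\<lambda>z. a \<bullet> z) ` {z. lp_norm 1 z \<le> 1}"
  then obtain z where z: "lp_norm 1 z \<le> 1" "v = a \<bullet> z" by blast
  have "v \<le> (\<Sum>i\<in>UNIV. lp_norm \<infinity> a * \<bar>z $ i\<bar>)"
    unfolding z(2) inner_vec_def
  proof (rule sum_mono)
    fix i
    have "a $ i \<bullet> z $ i \<le> \<bar>a $ i\<bar> * \<bar>z $ i\<bar>"
      by (metis abs_ge_self abs_mult inner_real_def)
    also have "\<dots> \<le> lp_norm \<infinity> a * \<bar>z $ i\<bar>"
      by (rule mult_right_mono) (auto intro: lp_norm_infinity_ge)
    finally show "a $ i \<bullet> z $ i \<le> lp_norm \<infinity> a * \<bar>z $ i\<bar>" .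
  qed
  also have "\<dots> = lp_norm \<infinity> a * lp_norm 1 z"
    by (simp add: lp_norm_1 sum_distrib_left)
  also have "\<dots> \<le> lp_norm \<infinity> a"
    using z(1) order_trans[OF abs_ge_zero lp_norm_infinity_ge[of a]] by (simp add: mult_left_le)
  finally show "v \<le> lp_norm \<infinity> a" .
qed

lemma dual_norm_lp_infinity: "dual_norm (lp_norm \<infinity>) a = lp_norm 1 a"
  unfolding dual_norm_def
proof (rule cSup_eq_maximum)
  let ?z = "\<chi> i. sgn (a $ i)"
  have "lp_norm \<infinity> ?z \<le> 1"
    unfolding lp_norm_infinity by (subst Max_le_iff) (auto simp: sgn_if)
  moreover have "a \<bullet> ?z = lp_norm 1 a"
    by (simp add: inner_vec_def lp_norm_1 abs_sgn)
  ultimately show "lp_norm 1 a \<in> (\<lambda>z. a \<bullet> z) ` {z. lp_norm \<infinity> z \<le> 1}"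
    by (metis imageI mem_Collect_eq)
next
  fix v assume "v \<in> (\<lambda>z. a \<bullet> z) ` {z. lp_norm \<infinity> z \<le> 1}"
  then obtain z where z: "lp_norm \<infinity> z \<le> 1" "v = a \<bullet> z" by blast
  show "v \<le> lp_norm 1 a"
    unfolding z(2) inner_vec_def lp_norm_1
  proof (rule sum_mono)
    fix i
    have "a $ i \<bullet> z $ i \<le> \<bar>a $ i\<bar> * \<bar>z $ i\<bar>"
      by (metis abs_ge_self abs_mult inner_real_def)
    also have "\<dots> \<le> \<bar>a $ i\<bar>"
      using order_trans[OF lp_norm_infinity_ge z(1)] by (simp add: mult_left_le)
    finally show "a $ i \<bullet> z $ i \<le> \<bar>a $ i\<bar>" .
  qed
qed

end

theory Submission
  imports Defs
begin

text \<open>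
  Up to a positive factor, the objective is a sum of minima of an affine function minus a
  nonnegative multiple of a polyhedral norm of an affine map, hence a pointwise minimum of
  finitely many affine functions \<open>g c\<close>. As \<open>X\<close> is compact, some \<open>D\<close> bounds all differences
  \<open>g c x - g c' x\<close> on \<open>X\<close>, and \<open>t\<close> is at least the minimum at \<open>x\<close> iff there is an integer point \<open>z\<close>
  of the standard simplex with \<open>g c x - D * (1 - z c) \<le> t\<close> for every \<open>c\<close>.
\<close>

section \<open>Topology of the ambient space\<close>

text \<open>Each \<open>Euclidean_space n\<close> carries the subspace topology from
  \<open>nat \<Rightarrow> real\<close>, so the product is again a subspace of a product type.
  Relative closedness then follows from plain \<open>closed\<close>.\<close>

lemma prod_topology_Euclidean_space:
  "prod_topology euclidean (prod_topology (Euclidean_space r) (Euclidean_space d)) =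
    top_of_set (UNIV \<times> topspace (Euclidean_space r) \<times> topspace (Euclidean_space d))"
proof -
  have E: "Euclidean_space n = top_of_set (topspace (Euclidean_space n))" for n
    by (simp add: Euclidean_space_def euclidean_product_topology topspace_Euclidean_space)
  have "prod_topology euclidean (prod_topology (top_of_set S) (top_of_set T)) = top_of_set (UNIV \<times> S \<times> T)"
    for S T :: "(nat \<Rightarrow> real) set"
    using prod_topology_subtopology_eu[of UNIV "S \<times> T"] by simp
  from this[of "topspace (Euclidean_space r)" "topspace (Euclidean_space d)"] show ?thesis
    by (simp only: E[symmetric])
qed

lemma closed_topspace_Euclidean_space: "closed (topspace (Euclidean_space n))"
proof -
  have "topspace (Euclidean_space n) = (\<Inter>i\<in>{n..}. {x. x i = 0})"
    by (auto simp: topspace_Euclidean_space)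
  moreover have "closed {x::nat \<Rightarrow> real. x i = 0}" for i
    by (intro closed_Collect_eq continuous_on_const
        continuous_on_product_then_coordinatewise[where f = "\<lambda>x. x"] continuous_on_id)
  ultimately show ?thesis by auto
qed

text \<open>No auxiliary variables are used: for \<open>r = d = 0\<close> both extra factors consist
  of the zero function alone.\<close>

lemma micp_r_set_closed_convex:
  assumes "closed X" "convex X"
  shows "micp_r_set X"
  unfolding micp_r_set_def
proof (intro exI conjI allI)
  let ?T = "topspace (Euclidean_space 0)"
  let ?M = "X \<times> ?T \<times> ?T"
  show "closedin (prod_topology euclidean (prod_topology (Euclidean_space 0) (Euclidean_space 0))) ?M"
    unfolding prod_topology_Euclidean_space
    by (intro closed_subset closed_Times closed_topspace_Euclidean_space assms) auto
  show "convex_ambient ?M"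
    using convexD[OF assms(2)] by (auto simp: convex_ambient_def topspace_Euclidean_space)
  show "x \<in> X \<longleftrightarrow> (\<exists>y\<in>?T. \<exists>z\<in>?T. (\<forall>i<0. z i \<in> \<int>) \<and> (x, y, z) \<in> ?M)" for x
    by (auto simp: topspace_Euclidean_space)
qed

section \<open>Calculus of pointwise minima of finitely many convex functions\<close>

text \<open>
  Being a pointwise minimum is stated through lower bounds and attainment, so that \<open>Min\<close> over a
  set of function values does not occur.
\<close>

definition min_of_convex :: "'a::euclidean_space set \<Rightarrow> ('a \<Rightarrow> real) \<Rightarrow> bool" where
  "min_of_convex X f \<longleftrightarrow>
    (\<exists>G. finite G \<and> (\<forall>g\<in>G. convex_on X g \<and> continuous_on X g) \<and>
      (\<forall>x\<in>X. (\<forall>g\<in>G. f x \<le> g x) \<and> (\<exists>g\<in>G. f x = g x)))"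

lemma min_of_convexI:
  assumes "finite G" "\<forall>g\<in>G. convex_on X g \<and> continuous_on X g"
    "\<forall>x\<in>X. (\<forall>g\<in>G. f x \<le> g x) \<and> (\<exists>g\<in>G. f x = g x)"
  shows "min_of_convex X f"
  unfolding min_of_convex_def by (intro exI[of _ G] conjI assms)

lemma min_of_convexE:
  assumes "min_of_convex X f"
  obtains G where "finite G" "\<And>g. g \<in> G \<Longrightarrow> convex_on X g" "\<And>g. g \<in> G \<Longrightarrow> continuous_on X g"
    "\<And>x g. x \<in> X \<Longrightarrow> g \<in> G \<Longrightarrow> f x \<le> g x" "\<And>x. x \<in> X \<Longrightarrow> \<exists>g\<in>G. f x = g x"
proof -
  obtain G where "finite G" "\<forall>g\<in>G. convex_on X g \<and> continuous_on X g"
      "\<forall>x\<in>X. (\<forall>g\<in>G. f x \<le> g x) \<and> (\<exists>g\<in>G. f x = g x)"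
    using assms unfolding min_of_convex_def by (elim exE conjE)
  then show thesis by (intro that[of G]) simp_all
qed

lemma min_of_convex_convex:
  assumes "convex_on X f" "continuous_on X f"
  shows "min_of_convex X f"
  by (rule min_of_convexI[of "{f}"]) (simp_all add: assms)

text \<open>The two minimizing pieces can be chosen independently, so every sum of a piece of
  \<open>f\<close> and a piece of \<open>h\<close> becomes a piece.\<close>

lemma min_of_convex_add:
  assumes "min_of_convex X f" "min_of_convex X h"
  shows "min_of_convex X (\<lambda>x. f x + h x)"
proof -
  obtain F where F: "finite F" "\<And>g. g \<in> F \<Longrightarrow> convex_on X g" "\<And>g. g \<in> F \<Longrightarrow> continuous_on X g"
    "\<And>x g. x \<in> X \<Longrightarrow> g \<in> F \<Longrightarrow> f x \<le> g x" "\<And>x. x \<in> X \<Longrightarrow> \<exists>g\<in>F. f x = g x"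
    by (fact min_of_convexE[OF assms(1)])
  obtain H where H: "finite H" "\<And>g. g \<in> H \<Longrightarrow> convex_on X g" "\<And>g. g \<in> H \<Longrightarrow> continuous_on X g"
    "\<And>x g. x \<in> X \<Longrightarrow> g \<in> H \<Longrightarrow> h x \<le> g x" "\<And>x. x \<in> X \<Longrightarrow> \<exists>g\<in>H. h x = g x"
    by (fact min_of_convexE[OF assms(2)])
  let ?G = "(\<lambda>(p, q) x. p x + q x) ` (F \<times> H)"
  have "finite ?G" using F(1) H(1) by auto
  moreover have "\<forall>g\<in>?G. convex_on X g \<and> continuous_on X g"
    using F(2,3) H(2,3) by (auto intro!: convex_on_add continuous_on_add)
  moreover have "\<forall>x\<in>X. (\<forall>g\<in>?G. f x + h x \<le> g x) \<and> (\<exists>g\<in>?G. f x + h x = g x)"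
    using F(4,5) H(4,5) by (fastforce intro: add_mono)
  ultimately show ?thesis by (rule min_of_convexI)
qed

lemma min_of_convex_cmul:
  assumes "0 \<le> c" "min_of_convex X f"
  shows "min_of_convex X (\<lambda>x. c * f x)"
proof -
  obtain F where F: "finite F" "\<And>g. g \<in> F \<Longrightarrow> convex_on X g" "\<And>g. g \<in> F \<Longrightarrow> continuous_on X g"
    "\<And>x g. x \<in> X \<Longrightarrow> g \<in> F \<Longrightarrow> f x \<le> g x" "\<And>x. x \<in> X \<Longrightarrow> \<exists>g\<in>F. f x = g x"
    by (fact min_of_convexE[OF assms(2)])
  let ?G = "(\<lambda>p x. c * p x) ` F"
  have "\<forall>g\<in>?G. convex_on X g \<and> continuous_on X g"
    using F(2,3) assms(1) by (auto intro!: convex_on_cmul continuous_on_mult_left)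
  moreover have "\<forall>x\<in>X. (\<forall>g\<in>?G. c * f x \<le> g x) \<and> (\<exists>g\<in>?G. c * f x = g x)"
    using F(4,5) assms(1) by (fastforce intro: mult_left_mono)
  ultimately show ?thesis using F(1) by (intro min_of_convexI[of ?G]) auto
qed

lemma min_of_convex_sum:
  assumes "convex X" "\<And>i. i \<in> I \<Longrightarrow> min_of_convex X (f i)"
  shows "min_of_convex X (\<lambda>x. \<Sum>i\<in>I. f i x)"
proof -
  \<comment> \<open>Covers the sum over an empty or infinite \<open>I\<close>. Convexity of
    \<open>X\<close> enters because \<open>convex_on\<close> demands a convex domain.\<close>
  have 0: "min_of_convex X (\<lambda>x. 0)"
    using assms(1) by (intro min_of_convex_convex) (auto simp: convex_on_def)
  show ?thesis
    using assms(2) by (induction I rule: infinite_finite_induct) (auto intro: 0 min_of_convex_add)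
qed

text \<open>A minimum of minima is the minimum over the union of the families of pieces.\<close>

lemma min_of_convex_Min:
  assumes "finite I" "I \<noteq> {}" "\<And>i. i \<in> I \<Longrightarrow> min_of_convex X (f i)"
  shows "min_of_convex X (\<lambda>x. MIN i\<in>I. f i x)"
proof -
  have "\<forall>i\<in>I. \<exists>G. finite G \<and> (\<forall>g\<in>G. convex_on X g \<and> continuous_on X g) \<and>
      (\<forall>x\<in>X. (\<forall>g\<in>G. f i x \<le> g x) \<and> (\<exists>g\<in>G. f i x = g x))"
    using assms(3) unfolding min_of_convex_def by blast
  from bchoice[OF this] obtain G where
    "\<forall>i\<in>I. finite (G i) \<and> (\<forall>g\<in>G i. convex_on X g \<and> continuous_on X g) \<and>
      (\<forall>x\<in>X. (\<forall>g\<in>G i. f i x \<le> g x) \<and> (\<exists>g\<in>G i. f i x = g x))"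
    by (rule exE)
  then have G: "\<And>i. i \<in> I \<Longrightarrow> finite (G i)"
      "\<And>i g. i \<in> I \<Longrightarrow> g \<in> G i \<Longrightarrow> convex_on X g \<and> continuous_on X g"
      "\<And>i x g. i \<in> I \<Longrightarrow> x \<in> X \<Longrightarrow> g \<in> G i \<Longrightarrow> f i x \<le> g x"
      "\<And>i x. i \<in> I \<Longrightarrow> x \<in> X \<Longrightarrow> \<exists>g\<in>G i. f i x = g x"
    by simp_all
  let ?m = "\<lambda>x. MIN i\<in>I. f i x"
  have "?m x \<le> g x" if "x \<in> X" "i \<in> I" "g \<in> G i" for x g i
    by (rule order_trans[OF Min_le G(3)[OF that(2,1,3)]]) (use assms(1) that(2) in auto)
  moreover have "\<exists>g\<in>\<Union> (G ` I). ?m x = g x" if "x \<in> X" for x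
  proof -
    have "?m x \<in> (\<lambda>i. f i x) ` I" using assms(1,2) by (intro Min_in) auto
    then show ?thesis using G(4)[OF _ that] by fastforce
  qed
  ultimately show ?thesis
    using assms(1) G(1,2) by (intro min_of_convexI[of "\<Union> (G ` I)"]) auto
qed

section \<open>Mixed-integer formulation of the epigraph\<close>

text \<open>Big-M disjunction with one indicator variable per piece and no continuous auxiliary
  variables. Convex pieces suffice: each constraint is convex jointly in the point, \<open>t\<close>
  and \<open>z\<close>.\<close>

lemma micp_r_fun_min_of_convex:
  fixes X :: "'a::euclidean_space set"
  assumes "compact X" "convex X" "min_of_convex X f"
  shows "micp_r_fun X f"
proof -
  obtain G where G: "finite G" "\<And>g. g \<in> G \<Longrightarrow> convex_on X g" "\<And>g. g \<in> G \<Longrightarrow> continuous_on X g"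
    "\<And>x g. x \<in> X \<Longrightarrow> g \<in> G \<Longrightarrow> f x \<le> g x" "\<And>x. x \<in> X \<Longrightarrow> \<exists>g\<in>G. f x = g x"
    by (fact min_of_convexE[OF assms(3)])
  \<comment> \<open>The pieces are numbered below \<open>d\<close> to match the coordinates of
    \<open>z\<close>.\<close>
  obtain d and g :: "nat \<Rightarrow> 'a \<Rightarrow> real" where Gg: "G = g ` {i. i < d}"
    using finite_imp_nat_seg_image_inj_on[OF G(1)] by metis
  have cvx: "convex_on X (g c)" and cont: "continuous_on X (g c)" and le: "x \<in> X \<Longrightarrow> f x \<le> g c x"
    if "c < d" for c x
    using G(2-4) that by (auto simp: Gg)
  have att: "\<exists>c<d. f x = g c x" if "x \<in> X" for x
    using G(5)[OF that] by (auto simp: Gg)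
  have "bounded (\<Union>c<d. g c ` X)"
    by (intro bounded_UN) (auto intro: compact_imp_bounded compact_continuous_image assms(1) cont)
  then obtain B where B: "\<And>c x. c < d \<Longrightarrow> x \<in> X \<Longrightarrow> \<bar>g c x\<bar> \<le> B"
    unfolding bounded_iff by fastforce
  \<comment> \<open>Values in \<open>[-B, B]\<close> differ by at most \<open>2 * B\<close>. Hence
    at \<open>z c = 0\<close> the constraint \<open>g c x - D \<le> t\<close> holds whenever
    \<open>x \<in> X\<close> and \<open>f x \<le> t\<close>.\<close>
  define D where "D = 2 * B"
  let ?T = "\<lambda>n. topspace (Euclidean_space n)"
  define E :: "(('a \<times> real) \<times> (nat \<Rightarrow> real) \<times> (nat \<Rightarrow> real)) set"
    where "E = (X \<times> UNIV) \<times> ?T 0 \<times> ?T d"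
  define M where "M = {q \<in> E. (\<forall>c<d. 0 \<le> snd (snd q) c) \<and> (\<Sum>c<d. snd (snd q) c) = 1 \<and>
      (\<forall>c<d. g c (fst (fst q)) - D * (1 - snd (snd q) c) \<le> snd (fst q))}"
  have "closed E"
    unfolding E_def
    by (intro closed_Times closed_topspace_Euclidean_space closed_UNIV compact_imp_closed assms(1))
  have fstE: "fst (fst q) \<in> X" if "q \<in> E" for q
    using that by (auto simp: E_def)
  have z_cont: "continuous_on S (\<lambda>q. snd (snd q) c)"
    for S :: "(('a \<times> real) \<times> (nat \<Rightarrow> real) \<times> (nat \<Rightarrow> real)) set" and c
    by (rule continuous_on_product_then_coordinatewise) (intro continuous_intros)
  \<comment> \<open>The equation is split into two inequalities, and each set is cut out of the
    closed set \<open>E\<close>, since continuity of \<open>g c\<close> is known only on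
    \<open>X\<close>.\<close>
  have M_eq: "M = E \<inter> (\<Inter>c\<in>{..<d}. {q \<in> E. 0 \<le> snd (snd q) c}) \<inter> {q \<in> E. (\<Sum>c<d. snd (snd q) c) \<le> 1}
     \<inter> {q \<in> E. 1 \<le> (\<Sum>c<d. snd (snd q) c)}
     \<inter> (\<Inter>c\<in>{..<d}. {q \<in> E. g c (fst (fst q)) - D * (1 - snd (snd q) c) \<le> snd (fst q)})"
    by (auto simp: M_def)
  have "closed M"
    unfolding M_eq
    by (intro closed_Int closed_INT ballI continuous_on_closed_Collect_le continuous_intros z_cont
          \<open>closed E\<close> continuous_on_compose2[OF cont]) (auto dest: fstE)
  then have cl: "closedin (prod_topology euclidean (prod_topology (Euclidean_space 0) (Euclidean_space d))) M"
    unfolding prod_topology_Euclidean_space by (intro closed_subset) (auto simp: M_def E_def)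
  have conv: "convex_ambient M"
    unfolding convex_ambient_def
  proof (intro allI impI, elim conjE)
    fix w w' :: "'a \<times> real" and y z y' z' and s t :: real
    assume q: "(w, y, z) \<in> M" "(w', y', z') \<in> M" and st: "0 \<le> s" "0 \<le> t" "s + t = 1"
    have X: "fst w \<in> X" "fst w' \<in> X"
      using q by (auto simp: M_def E_def)
    have sum: "(\<Sum>c<d. s * z c + t * z' c) = 1"
      using q st by (simp add: M_def sum.distrib flip: sum_distrib_left)
    have "g c (s *\<^sub>R fst w + t *\<^sub>R fst w') - D * (1 - (s * z c + t * z' c)) \<le> s * snd w + t * snd w'"
      if c: "c < d" for c
    proof -
      have "g c (s *\<^sub>R fst w + t *\<^sub>R fst w') \<le> s * g c (fst w) + t * g c (fst w')"
        using cvx[OF c] X st unfolding convex_on_def by blast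
      also have "\<dots> \<le> s * (snd w + D * (1 - z c)) + t * (snd w' + D * (1 - z' c))"
        using q c st by (intro add_mono mult_left_mono) (auto simp: M_def algebra_simps)
      \<comment> \<open>The penalties are affine in \<open>z\<close>, so they combine exactly;
        \<open>s + t\<close> becomes the 1 of the claim.\<close>
      also have "\<dots> = s * snd w + t * snd w' + D * ((s + t) - (s * z c + t * z' c))"
        by (simp add: algebra_simps)
      finally show ?thesis using st by simp
    qed
    moreover have "s *\<^sub>R fst w + t *\<^sub>R fst w' \<in> X"
      using assms(2) X st by (rule convexD)
    ultimately show "(s *\<^sub>R w + t *\<^sub>R w', \<lambda>i. s * y i + t * y' i, \<lambda>i. s * z i + t * z' i) \<in> M"
      using q st sum by (auto simp: M_def E_def topspace_Euclidean_space)
  qed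
  have "w \<in> {(x, t). x \<in> X \<and> f x \<le> t} \<longleftrightarrow>
      (\<exists>y\<in>?T 0. \<exists>z\<in>?T d. (\<forall>i<d. z i \<in> \<int>) \<and> (w, y, z) \<in> M)" for w
  proof
    assume "w \<in> {(x, t). x \<in> X \<and> f x \<le> t}"
    then obtain x t where w: "w = (x, t)" "x \<in> X" "f x \<le> t" by auto
    obtain c where c: "c < d" "f x = g c x" using att w(2) by blast
    \<comment> \<open>The unit vector at a piece attaining \<open>f x\<close>; it vanishes from
      index \<open>d\<close> on because \<open>c < d\<close>.\<close>
    let ?z = "\<lambda>i. if i = c then 1 else 0 :: real"
    have "g i x - D * (1 - ?z i) \<le> t" if "i < d" for i
      using B[OF that w(2)] B[OF c(1) w(2)] w(3) c(2) by (auto simp: D_def)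
    then have "(w, \<lambda>i. 0, ?z) \<in> M"
      using w c by (auto simp: M_def E_def topspace_Euclidean_space)
    moreover have "(\<lambda>i. 0) \<in> ?T 0" "?z \<in> ?T d" "\<forall>i<d. ?z i \<in> \<int>"
      using c by (auto simp: topspace_Euclidean_space)
    ultimately show "\<exists>y\<in>?T 0. \<exists>z\<in>?T d. (\<forall>i<d. z i \<in> \<int>) \<and> (w, y, z) \<in> M"
      by (intro bexI[of _ "\<lambda>i. 0"] bexI[of _ ?z] conjI)
  next
    assume "\<exists>y\<in>?T 0. \<exists>z\<in>?T d. (\<forall>i<d. z i \<in> \<int>) \<and> (w, y, z) \<in> M"
    then obtain y z where z: "\<forall>i<d. z i \<in> \<int>" and M: "(w, y, z) \<in> M" by blast
    have z0: "\<And>i. i < d \<Longrightarrow> 0 \<le> z i" and z1: "(\<Sum>i<d. z i) = 1" and X: "fst w \<in> X"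
      using M by (auto simp: M_def E_def)
    \<comment> \<open>A nonzero nonnegative integer is at least 1, and no summand exceeds the total
      1. So \<open>z c = 1\<close>, and the constraint for \<open>c\<close> loses its
      penalty.\<close>
    obtain c where c: "c < d" "z c \<noteq> 0"
      using z1 by (metis lessThan_iff sum.neutral zero_neq_one)
    have "z c \<le> 1"
      using member_le_sum[of c "{..<d}" z] c(1) z0 z1 by auto
    moreover have "1 \<le> z c"
      using Ints_nonzero_abs_ge1[of "z c"] z c z0[OF c(1)] by auto
    ultimately have "z c = 1" by simp
    moreover have "g c (fst w) - D * (1 - z c) \<le> snd w"
      using M c(1) by (auto simp: M_def)
    ultimately show "w \<in> {(x, t). x \<in> X \<and> f x \<le> t}"
      using le[OF c(1) X] X by (auto simp: case_prod_unfold)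
  qed
  then have "micp_r_set {(x, t). x \<in> X \<and> f x \<le> t}"
    unfolding micp_r_set_def using cl conv by blast
  then show ?thesis
    unfolding micp_r_fun_def
    using micp_r_set_closed_convex compact_imp_closed assms(1,2) by blast
qed

section \<open>Affine functions and negated polyhedral norms\<close>

lemma min_of_convex_affine:
  fixes B :: "'a::euclidean_space"
  assumes "convex X"
  shows "min_of_convex X (\<lambda>x. B \<bullet> x + c)"
proof (rule min_of_convex_convex)
  show "convex_on X (\<lambda>x. B \<bullet> x + c)"
  proof (rule convex_onI)
    fix t :: real and x y
    have "B \<bullet> ((1 - t) *\<^sub>R x + t *\<^sub>R y) + c = (1 - t) * (B \<bullet> x + c) + t * (B \<bullet> y + c)"
      by (simp add: inner_simps algebra_simps)
    then show "B \<bullet> ((1 - t) *\<^sub>R x + t *\<^sub>R y) + c \<le> (1 - t) * (B \<bullet> x + c) + t * (B \<bullet> y + c)"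
      by simp
  qed (fact assms)
qed (intro continuous_intros)

text \<open>Although concave, the function is the minimum of the affine function and its negative,
  one piece for each sign \<open>s\<close>.\<close>

lemma min_of_convex_neg_abs_affine:
  fixes B :: "'a::euclidean_space"
  assumes "convex X"
  shows "min_of_convex X (\<lambda>x. - \<bar>B \<bullet> x + c\<bar>)"
proof -
  have "min_of_convex X (\<lambda>x. MIN s\<in>{1, -1}. (s *\<^sub>R B) \<bullet> x + s * c)"
    by (intro min_of_convex_Min min_of_convex_affine assms) auto
  moreover have "(\<lambda>x. MIN s\<in>{1, -1}. (s *\<^sub>R B) \<bullet> x + s * c) = (\<lambda>x. - \<bar>B \<bullet> x + c\<bar>)"
    by (auto simp: fun_eq_iff min_def abs_if)
  ultimately show ?thesis by simp
qed

text \<open>The dual norm is the maximum (\<open>p = 1\<close>) or the sum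
  (\<open>p = \<infinity>\<close>) of the absolute components. Its negative is therefore a minimum
  or a sum of terms \<open>- \<bar>B \<bullet> x + c\<bar>\<close>.\<close>

lemma min_of_convex_neg_dual_lp_norm:
  fixes A :: "real ^ 'n ^ 'm"
  assumes "convex X" "p \<in> {1, \<infinity>}"
  shows "min_of_convex X (\<lambda>x. - dual_norm (lp_norm p) (A *v x + v))"
proof -
  have comp: "(A *v x + v) $ i = A $ i \<bullet> x + v $ i" for x i
    by (simp add: matrix_vector_mul_component)
  consider "p = 1" | "p = \<infinity>" using assms(2) by blast
  then show ?thesis
  proof cases
    case 1
    have "- lp_norm \<infinity> (A *v x + v) = (MIN i. - \<bar>A $ i \<bullet> x + v $ i\<bar>)" for x
      unfolding lp_norm_infinity comp by (simp add: image_image)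
    then show ?thesis
      unfolding 1 dual_norm_lp_1
      by (auto intro!: min_of_convex_Min min_of_convex_neg_abs_affine assms(1))
  next
    case 2
    have "- lp_norm 1 (A *v x + v) = (\<Sum>i\<in>UNIV. - \<bar>A $ i \<bullet> x + v $ i\<bar>)" for x
      unfolding lp_norm_1 comp by (simp add: sum_negf)
    then show ?thesis
      unfolding 2 dual_norm_lp_infinity
      by (simp add: min_of_convex_sum min_of_convex_neg_abs_affine assms(1))
  qed
qed

section \<open>Interval bounds and the conclusion\<close>

text \<open>Each summand is monotone in \<open>x $ j\<close>, increasing or decreasing with the sign
  of \<open>B $ j\<close>, so its extremes lie at the endpoints \<open>l $ j\<close> and
  \<open>u $ j\<close>.\<close>

lemma affine_cbox_bounds:
  fixes B x l u :: "real ^ 'n"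
  assumes "x \<in> cbox l u"
  shows "B \<bullet> x + c \<in> {(\<Sum>j\<in>UNIV. min (B $ j * l $ j) (B $ j * u $ j)) + c..
    (\<Sum>j\<in>UNIV. max (B $ j * l $ j) (B $ j * u $ j)) + c}"
proof -
  have "min (B $ j * l $ j) (B $ j * u $ j) \<le> B $ j * x $ j \<and>
      B $ j * x $ j \<le> max (B $ j * l $ j) (B $ j * u $ j)" for j
  proof -
    have "l $ j \<le> x $ j" "x $ j \<le> u $ j" using assms by (auto simp: mem_box_cart)
    then show ?thesis
      by (cases "0 \<le> B $ j")
        (auto intro: mult_left_mono mult_left_mono_neg simp: min_le_iff_disj le_max_iff_disj)
  qed
  then show ?thesis
    by (auto simp: inner_vec_def intro!: sum_mono)
qed

theorem theorem5:
  fixes X :: "(real ^ 'n) set"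
    and Ahat :: "nat \<Rightarrow> real ^ 'n ^ 'm" and ahat :: "nat \<Rightarrow> real ^ 'm"
    and Bhat :: "nat \<Rightarrow> real ^ 'n" and bhat :: "nat \<Rightarrow> real"
    and a :: "nat \<Rightarrow> real ^ 'n \<Rightarrow> real ^ 'm" and b :: "nat \<Rightarrow> real ^ 'n \<Rightarrow> real"
    and \<zeta> :: "nat \<Rightarrow> real ^ 'm" and K N :: nat and \<theta> :: real and p :: ereal
    and l u :: "real ^ 'n"
    and lb ub :: "nat \<Rightarrow> real" and la ua :: "nat \<Rightarrow> 'm \<Rightarrow> real"
  assumes "K \<ge> 1" and "N \<ge> 1"
    and "compact X" and "convex X" and "rel_interior X \<noteq> {}"
    and "\<And>k x. a k x = Ahat k *v x + ahat k"
    and "\<And>k x. b k x = Bhat k \<bullet> x + bhat k"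
    and "\<theta> \<ge> 0"
    and "X \<subseteq> cbox l u"
    and "\<And>k. lb k = (\<Sum>j\<in>UNIV. min (Bhat k $ j * l $ j) (Bhat k $ j * u $ j)) + bhat k"
    and "\<And>k. ub k = (\<Sum>j\<in>UNIV. max (Bhat k $ j * l $ j) (Bhat k $ j * u $ j)) + bhat k"
    and "\<And>k i. la k i =
           (\<Sum>j\<in>UNIV. min (Ahat k $ i $ j * l $ j) (Ahat k $ i $ j * u $ j)) + ahat k $ i"
    and "\<And>k i. ua k i =
           (\<Sum>j\<in>UNIV. max (Ahat k $ i $ j * l $ j) (Ahat k $ i $ j * u $ j)) + ahat k $ i"
    and "p \<in> {1, \<infinity>}"
  shows "(\<forall>k\<in>{1..K}. \<forall>x\<in>X. b k x \<in> {lb k..ub k}) \<and>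
    (\<forall>k\<in>{1..K}. \<forall>x\<in>X. \<forall>i. a k x $ i \<in> {la k i..ua k i}) \<and>
    micp_r_program X
      (\<lambda>x. 1 / real N * (\<Sum>i\<in>{1..N}. MIN k\<in>{1..K}.
              \<zeta> i \<bullet> a k x + b k x - \<theta> * dual_norm (lp_norm p) (a k x)))"
proof -
  note a = assms(6) and b = assms(7)
  have box: "x \<in> cbox l u" if "x \<in> X" for x
    using assms(9) that by blast
  have comp: "a k x $ i = Ahat k $ i \<bullet> x + ahat k $ i" for k x i
    by (simp add: a matrix_vector_mul_component)
  \<comment> \<open>Moving \<open>Ahat k\<close> across the inner product by its transpose exhibits
    one affine function of \<open>x\<close>.\<close>
  have aff: "\<zeta> i \<bullet> a k x + b k x =
      (transpose (Ahat k) *v \<zeta> i + Bhat k) \<bullet> x + (\<zeta> i \<bullet> ahat k + bhat k)" for i k x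
    by (simp add: a b inner_simps dot_lmul_matrix)
  \<comment> \<open>The subtraction is written as \<open>\<theta>\<close> times a negated norm, so
    that only sums and nonnegative multiples occur.\<close>
  have "min_of_convex X (\<lambda>x. \<zeta> i \<bullet> a k x + b k x + \<theta> * (- dual_norm (lp_norm p) (a k x)))" for i k
    unfolding aff unfolding a
    by (intro min_of_convex_add min_of_convex_affine min_of_convex_cmul
        min_of_convex_neg_dual_lp_norm assms)
  then have "min_of_convex X (\<lambda>x. 1 / real N * (\<Sum>i\<in>{1..N}. MIN k\<in>{1..K}.
      \<zeta> i \<bullet> a k x + b k x - \<theta> * dual_norm (lp_norm p) (a k x)))"
    using assms(1,4) by (intro min_of_convex_cmul min_of_convex_sum min_of_convex_Min) auto
  then have "micp_r_program X (\<lambda>x. 1 / real N * (\<Sum>i\<in>{1..N}. MIN k\<in>{1..K}.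
      \<zeta> i \<bullet> a k x + b k x - \<theta> * dual_norm (lp_norm p) (a k x)))"
    using micp_r_fun_min_of_convex[OF assms(3,4)] by (auto simp: micp_r_program_def micp_r_fun_def)
  then show ?thesis
    unfolding comp assms(10-13) b using affine_cbox_bounds[OF box] by blast
qed

end
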